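(* For every class of monotone valuations, with or without budgets, the price of anarchy (with respect to liquid welfare) of NOB-feasible coarse correlated equilibria of simultaneous second-price auctions is at most $2$. That is, for every simultaneous second-price auction instance $I$ with monotone valuations and budgets $B_i\in(0,\infty]$, and every NOB-feasible coarse correlated equilibrium $A$ of $I$, $\mathrm{OPT}(I)\le2\,\mathrm{LW}(I,A)$.
   Context: Simultaneous second-price auction: bidders $N=[n]$, $n\ge2$; items $M=[m]$, $m\ge1$. Bidder $i$ submits $a_i=(a_{ij})_{j\in M}\in\mathcal A_i=\mathbb R_{\ge0}^m$; $\mathcal A=\prod_i\mathcal A_i$. Each item $j$ is awarded to exactly one bidder among those with the highest bid on $j$, ties being resolved by a fixed order over bidders; $X_i(a)\subseteq M$ is the set of items won by $i$, and $i$ pays $P_i(a)=\sum_{j\in X_i(a)}\max_{\ell\ne i}a_{\ell j}$. Bidder $i$ has a monotone valuation $v_i:2^M\to\mathbb R_{\ge0}$, $v_i(\emptyset)=0$, and a budget $B_i\in(0,\infty]$. Utility: $u_i(a)=v_i(X_i(a))-P_i(a)$. The feasible allocations $\mathcal X$ are the profiles $(x_i)_{i\in N}$ of pairwise disjoint subsets of $M$. $\Delta(S)$ denotes probability distributions on $S$. For $A\in\Delta(\mathcal A)$ let $A_{-i}$ be the marginal on the others' actions, and let $\mathcal C_i(A_{-i})$ be the set of $A_i'\in\Delta(\mathcal A_i)$ with $\mathbb E_{a_i'\sim A_i',a_{-i}\sim A_{-i}}[P_i(a_i',a_{-i})]\le B_i$ (independent draws). $A\in\Delta(\mathcal A)$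 is a coarse correlated equilibrium if for all $i$: $\mathbb E_{a\sim A}[P_i(a)]\le B_i$, and $\mathbb E_{a\sim A}[u_i(a)]\ge\mathbb E_{a_i'\sim A_i',a_{-i}\sim A_{-i}}[u_i(a_i',a_{-i})]$ for all $A_i'\in\mathcal C_i(A_{-i})$. $\mathrm{LW}(I,A)=\sum_i\min\{\mathbb E_{a\sim A}[v_i(X_i(a))],B_i\}$ and $\mathrm{OPT}(I)=\max_{\chi\in\Delta(\mathcal X)}\sum_i\min\{\mathbb E_{x\sim\chi}[v_i(x_i)],B_i\}$. The price of anarchy is the supremum of $\mathrm{OPT}(I)/\mathrm{LW}(I,A)$ over instances $I$ and equilibria $A$. NOB (no overbidding): let $W_i(a)=\sup\{P_i(a_i,a_{-i}'):X_i(a_i,a_{-i}')=X_i(a)\}$ (here $W_i(a)=\sum_{j\in X_i(a)}a_{ij}$). $A$ is NOB-feasible if $\sum_i\mathbb E_{a\sim A}[W_i(a)]\le\mathrm{LW}(I,A)$. Deviations are not restricted by NOB. *)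

theory Defs
  imports "HOL-Probability.Probability"
begin

text \<open>Bidders are the numbers below \<open>bidders I\<close> and items the numbers below \<open>items I\<close>.
  A pair \<open>(i, l) \<in> tie I\<close> means that ties between \<open>i\<close> and \<open>l\<close> are resolved in favour of \<open>i\<close>.
  The budget \<open>\<infinity>\<close> means that the bidder is not budget constrained.\<close>

record auction =
  bidders :: nat
  items :: nat
  val :: "nat \<Rightarrow> nat set \<Rightarrow> real"
  budget :: "nat \<Rightarrow> ereal"
  tie :: "(nat \<times> nat) set"

definition monotone_valuation :: "nat \<Rightarrow> (nat set \<Rightarrow> real) \<Rightarrow> bool" where
  "monotone_valuation m v \<longleftrightarrow>
     v {} = 0 \<and> (\<forall>S\<subseteq>{..<m}. 0 \<le> v S) \<and> mono_on (Pow {..<m}) v"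

definition second_price_auction :: "auction \<Rightarrow> bool" where
  "second_price_auction I \<longleftrightarrow>
     2 \<le> bidders I \<and> 1 \<le> items I \<and>
     linear_order_on {..<bidders I} (tie I) \<and>
     (\<forall>i<bidders I. monotone_valuation (items I) (val I i) \<and> 0 < budget I i)"

text \<open>The Borel spaces of actions of one bidder, and of action profiles of a set \<open>K\<close> of bidders.\<close>

definition action_space :: "auction \<Rightarrow> (nat \<Rightarrow> real) measure" where
  "action_space I = PiM {..<items I} (\<lambda>_. restrict_space borel {0..})"

definition profile_space :: "auction \<Rightarrow> nat set \<Rightarrow> (nat \<Rightarrow> nat \<Rightarrow> real) measure" where
  "profile_space I K = PiM K (\<lambda>_. action_space I)"

definition won :: "auction \<Rightarrow> nat \<Rightarrow> (nat \<Rightarrow> nat \<Rightarrow> real) \<Rightarrow> nat set" where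
  "won I i a = {j. j < items I \<and>
     (\<forall>l<bidders I. a l j < a i j \<or> (a l j = a i j \<and> (i, l) \<in> tie I))}"

lemma won_by_exactly_one:
  assumes "second_price_auction I" and "j < items I"
  shows "\<exists>!i. i < bidders I \<and> j \<in> won I i a"
proof -
  let ?N = "{..<bidders I}" and ?r = "tie I"
  from assms(1) have n: "2 \<le> bidders I" and lin: "linear_order_on ?N ?r"
    by (auto simp: second_price_auction_def)
  have "\<exists>i\<in>K. \<forall>l\<in>K. a l j < a i j \<or> (a l j = a i j \<and> (i, l) \<in> ?r)"
    if "finite K" "K \<noteq> {}" "K \<subseteq> ?N" for K
    using that
  proof (induction K rule: finite_ne_induct)
    case (singleton x)
    then show ?case using lin
      by (auto simp: linear_order_on_def partial_order_on_def preorder_on_def refl_on_def)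
  next
    case (insert x K)
    then obtain i where i: "i \<in> K"
      "\<forall>l\<in>K. a l j < a i j \<or> (a l j = a i j \<and> (i, l) \<in> ?r)" by auto
    have "x \<in> ?N" "i \<in> ?N" "x \<noteq> i" using insert.prems insert.hyps i(1) by auto
    then have rf: "(x, x) \<in> ?r" and tr: "trans ?r" and tot: "(x, i) \<in> ?r \<or> (i, x) \<in> ?r"
      using lin unfolding linear_order_on_def partial_order_on_def preorder_on_def refl_on_def
        total_on_def by blast+
    show ?case
    proof (cases "a x j < a i j \<or> (a x j = a i j \<and> (i, x) \<in> ?r)")
      case True
      then show ?thesis using i by blast
    next
      case False
      then have "a i j < a x j \<or> (a x j = a i j \<and> (x, i) \<in> ?r)" using tot by linarith
      then have "\<forall>l\<in>insert x K. a l j < a x j \<or> (a l j = a x j \<and> (x, l) \<in> ?r)"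
        using i rf tr by (fastforce dest: transD)
      then show ?thesis by blast
    qed
  qed
  from this[of ?N] n obtain i where "i < bidders I" "j \<in> won I i a"
    using assms(2) by (auto simp: won_def lessThan_empty_iff)
  moreover have "k = l" if "k < bidders I" "l < bidders I" "j \<in> won I k a" "j \<in> won I l a" for k l
  proof -
    from that have "(k, l) \<in> ?r" "(l, k) \<in> ?r" by (force simp: won_def)+
    then show ?thesis using lin
      by (auto simp: linear_order_on_def partial_order_on_def antisym_def)
  qed
  ultimately show ?thesis by blast
qed

definition payment :: "auction \<Rightarrow> nat \<Rightarrow> (nat \<Rightarrow> nat \<Rightarrow> real) \<Rightarrow> real" where
  "payment I i a = (\<Sum>j\<in>won I i a. Max ((\<lambda>l. a l j) ` ({..<bidders I} - {i})))"

definition utility :: "auction \<Rightarrow> nat \<Rightarrow> (nat \<Rightarrow> nat \<Rightarrow> real) \<Rightarrow> real" where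
  "utility I i a = val I i (won I i a) - payment I i a"

text \<open>Payments may have infinite expectation, so expectations are taken in the extended reals,
  as the expectation of the positive part minus that of the negative part. All functions below
  have a bounded positive part or are nonnegative, so the form \<open>\<infinity> - \<infinity>\<close> does not occur.\<close>

definition ext_expectation :: "'a measure \<Rightarrow> ('a \<Rightarrow> real) \<Rightarrow> ereal" where
  "ext_expectation M f =
     enn2ereal (\<integral>\<^sup>+ x. ennreal (f x) \<partial>M) - enn2ereal (\<integral>\<^sup>+ x. ennreal (- f x) \<partial>M)"

definition marginal_others ::
    "auction \<Rightarrow> nat \<Rightarrow> (nat \<Rightarrow> nat \<Rightarrow> real) measure \<Rightarrow> (nat \<Rightarrow> nat \<Rightarrow> real) measure" where
  "marginal_others I i A =
     distr A (profile_space I ({..<bidders I} - {i})) (\<lambda>a. restrict a ({..<bidders I} - {i}))"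

text \<open>The expectation of \<open>f\<close> when bidder \<open>i\<close> draws its action from \<open>D\<close> and, independently, the
  others draw theirs from the marginal \<open>A\<^sub>-\<^sub>i\<close>.\<close>

definition deviation_expectation ::
    "auction \<Rightarrow> nat \<Rightarrow> (nat \<Rightarrow> real) measure \<Rightarrow> (nat \<Rightarrow> nat \<Rightarrow> real) measure
      \<Rightarrow> ((nat \<Rightarrow> nat \<Rightarrow> real) \<Rightarrow> real) \<Rightarrow> ereal" where
  "deviation_expectation I i D A f =
     ext_expectation (D \<Otimes>\<^sub>M marginal_others I i A) (\<lambda>(b, a). f (a(i := b)))"

definition feasible_deviations ::
    "auction \<Rightarrow> nat \<Rightarrow> (nat \<Rightarrow> nat \<Rightarrow> real) measure \<Rightarrow> (nat \<Rightarrow> real) measure set" where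
  "feasible_deviations I i A =
     {D \<in> space (prob_algebra (action_space I)).
        deviation_expectation I i D A (payment I i) \<le> budget I i}"

definition coarse_correlated_equilibrium ::
    "auction \<Rightarrow> (nat \<Rightarrow> nat \<Rightarrow> real) measure \<Rightarrow> bool" where
  "coarse_correlated_equilibrium I A \<longleftrightarrow>
     A \<in> space (prob_algebra (profile_space I {..<bidders I})) \<and>
     (\<forall>i<bidders I.
        ext_expectation A (payment I i) \<le> budget I i \<and>
        (\<forall>D\<in>feasible_deviations I i A.
           deviation_expectation I i D A (utility I i) \<le> ext_expectation A (utility I i)))"

definition liquid_welfare :: "auction \<Rightarrow> (nat \<Rightarrow> nat \<Rightarrow> real) measure \<Rightarrow> ereal" where
  "liquid_welfare I A =
     (\<Sum>i<bidders I. min (ext_expectation A (\<lambda>a. val I i (won I i a))) (budget I i))"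

definition feasible_allocations :: "auction \<Rightarrow> (nat \<Rightarrow> nat set) set" where
  "feasible_allocations I =
     {x \<in> {..<bidders I} \<rightarrow>\<^sub>E Pow {..<items I}. disjoint_family_on x {..<bidders I}}"

text \<open>There are finitely many allocations, so their distributions form a compact simplex and the
  supremum is a maximum.\<close>

definition optimal_liquid_welfare :: "auction \<Rightarrow> ereal" where
  "optimal_liquid_welfare I =
     (SUP p\<in>{p. set_pmf p \<subseteq> feasible_allocations I}.
        \<Sum>i<bidders I. min (ext_expectation (measure_pmf p) (\<lambda>x. val I i (x i))) (budget I i))"

text \<open>The set below contains \<open>payment I i a\<close> and is bounded by the sum of the bids of \<open>i\<close> on the
  items won, so the supremum in the reals is the intended one.\<close>

definition maximal_payment :: "auction \<Rightarrow> nat \<Rightarrow> (nat \<Rightarrow> nat \<Rightarrow> real) \<Rightarrow> real" where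
  "maximal_payment I i a =
     Sup {payment I i (a'(i := a i)) | a'.
            a' \<in> space (profile_space I ({..<bidders I} - {i})) \<and>
            won I i (a'(i := a i)) = won I i a}"

definition nob_feasible :: "auction \<Rightarrow> (nat \<Rightarrow> nat \<Rightarrow> real) measure \<Rightarrow> bool" where
  "nob_feasible I A \<longleftrightarrow>
     (\<Sum>i<bidders I. ext_expectation A (maximal_payment I i)) \<le> liquid_welfare I A"

text \<open>\<open>\<V> m\<close> is the set of admissible valuations on \<open>m\<close> items, and \<open>\<B>\<close> the set of admissible
  budgets: \<open>{\<infinity>}\<close> for auctions without budgets, \<open>{0<..}\<close> for arbitrary budgets.\<close>

definition auction_class :: "(nat \<Rightarrow> (nat set \<Rightarrow> real) set) \<Rightarrow> ereal set \<Rightarrow> auction set" where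
  "auction_class \<V> \<B> =
     {I. second_price_auction I \<and>
         (\<forall>i<bidders I. val I i \<in> \<V> (items I) \<and> budget I i \<in> \<B>)}"

text \<open>In \<open>ereal\<close>, \<open>0 / 0 = 0\<close> and \<open>x / 0 = \<infinity>\<close> for \<open>x > 0\<close>: instances of zero optimum
  contribute ratio \<open>0\<close>, and zero welfare against a positive optimum gives an infinite ratio.\<close>

definition price_of_anarchy_nob_cce :: "(nat \<Rightarrow> (nat set \<Rightarrow> real) set) \<Rightarrow> ereal set \<Rightarrow> ereal" where
  "price_of_anarchy_nob_cce \<V> \<B> =
     Sup {optimal_liquid_welfare I / liquid_welfare I A | I A.
            I \<in> auction_class \<V> \<B> \<and> coarse_correlated_equilibrium I A \<and> nob_feasible I A}"

end

theory Submission
  imports Defs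
begin

text \<open>Let \<open>h\<^sub>j\<close> be the highest bid on item \<open>j\<close> and let \<open>x\<close> be a random allocation. Bidder \<open>i\<close> can
  deviate by drawing \<open>x\<close> and bidding a huge amount on \<open>x\<^sub>i\<close> and \<open>0\<close> elsewhere. Its expected payment
  is then at most \<open>Q\<^sub>i = \<Sum>\<^sub>j Pr[j \<in> x\<^sub>i] E[h\<^sub>j]\<close>. If \<open>Q\<^sub>i \<le> B\<^sub>i\<close>, the deviation is feasible and the
  equilibrium condition gives \<open>E[v\<^sub>i(x\<^sub>i)] - Q\<^sub>i \<le> E[v\<^sub>i(X\<^sub>i)]\<close> in the limit of large bids; otherwise
  \<open>Q\<^sub>i\<close> exceeds the capped value \<open>B\<^sub>i\<close>. In both cases the capped optimal value of \<open>i\<close> exceeds its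
  capped equilibrium value by at most \<open>Q\<^sub>i\<close>. As the sets \<open>x\<^sub>i\<close> are disjoint,
  \<open>\<Sum>\<^sub>i Q\<^sub>i \<le> \<Sum>\<^sub>j E[h\<^sub>j] = \<Sum>\<^sub>i E[W\<^sub>i]\<close>, which the no-overbidding condition bounds by the liquid welfare.\<close>

section \<open>Expectations in the extended reals and products of independent factors\<close>

lemma ext_expectation_cong:
  "(\<And>x. x \<in> space M \<Longrightarrow> f x = g x) \<Longrightarrow> ext_expectation M f = ext_expectation M g"
  unfolding ext_expectation_def by (auto cong: nn_integral_cong)

lemma ext_expectation_distr:
  assumes [measurable]: "g \<in> M \<rightarrow>\<^sub>M N" "f \<in> borel_measurable N"
  shows "ext_expectation (distr M N g) f = ext_expectation M (\<lambda>x. f (g x))"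
  unfolding ext_expectation_def by (simp add: nn_integral_distr)

lemma ext_expectation_integrable:
  assumes "integrable M f"
  shows "ext_expectation M f = ereal (\<integral>x. f x \<partial>M)"
proof -
  have "(\<integral>\<^sup>+ x. ennreal (f x) \<partial>M) < \<infinity>" "(\<integral>\<^sup>+ x. ennreal (- f x) \<partial>M) < \<infinity>"
    using assms by (auto simp: real_integrable_def top.not_eq_extremum)
  then show ?thesis
    unfolding ext_expectation_def real_lebesgue_integral_def[OF assms]
    by (cases "\<integral>\<^sup>+ x. ennreal (f x) \<partial>M"; cases "\<integral>\<^sup>+ x. ennreal (- f x) \<partial>M") auto
qed

lemma ext_expectation_nonneg:
  assumes "\<And>x. x \<in> space M \<Longrightarrow> 0 \<le> f x"
  shows "ext_expectation M f = enn2ereal (\<integral>\<^sup>+ x. ennreal (f x) \<partial>M)"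
proof -
  have "(\<integral>\<^sup>+ x. ennreal (- f x) \<partial>M) = (\<integral>\<^sup>+ x. 0 \<partial>M)"
    using assms by (intro nn_integral_cong) (auto simp: ennreal_neg)
  then show ?thesis unfolding ext_expectation_def by (simp add: zero_ennreal.rep_eq)
qed

text \<open>Lets the no-overbidding condition, an inequality in \<open>ereal\<close>, supply
  integrability.\<close>

lemma integrable_if_ext_expectation_finite:
  assumes "f \<in> borel_measurable M" "\<And>x. x \<in> space M \<Longrightarrow> 0 \<le> f x" "ext_expectation M f \<noteq> \<infinity>"
  shows "integrable M f"
proof (rule integrableI_nonneg)
  show "AE x in M. 0 \<le> f x" using assms(2) by simp
  have "ext_expectation M f = enn2ereal (\<integral>\<^sup>+ x. ennreal (f x) \<partial>M)"
    using assms(2) by (rule ext_expectation_nonneg)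
  then show "(\<integral>\<^sup>+ x. ennreal (f x) \<partial>M) < \<infinity>"
    using assms(3) by (cases "\<integral>\<^sup>+ x. ennreal (f x) \<partial>M") (auto simp: top_ennreal.rep_eq)
qed (use assms in auto)


text \<open>Fubini. The first factor depends on a random bundle and is bounded; the second is only
  integrable, since it may be a highest bid, which can be unbounded.\<close>

lemma integral_mult_independent:
  fixes u :: "'a \<Rightarrow> real" and h :: "'b \<Rightarrow> real"
  assumes "prob_space M" "prob_space N"
    and u[measurable]: "u \<in> borel_measurable M" and bnd: "\<And>x. \<bar>u x\<bar> \<le> C" and h: "integrable N h"
  shows "integrable (M \<Otimes>\<^sub>M N) (\<lambda>(x, y). u x * h y)"
    and "(\<integral>z. (\<lambda>(x, y). u x * h y) z \<partial>(M \<Otimes>\<^sub>M N)) = (\<integral>x. u x \<partial>M) * (\<integral>y. h y \<partial>N)"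
proof -
  interpret M: prob_space M by fact
  interpret N: prob_space N by fact
  interpret pair_sigma_finite M N ..
  have [measurable]: "h \<in> borel_measurable N" using h by simp
  have u_int: "integrable M u" by (rule M.integrable_const_bound[of _ C]) (use bnd u in auto)
  show int: "integrable (M \<Otimes>\<^sub>M N) (\<lambda>(x, y). u x * h y)"
  proof (rule Fubini_integrable)
    show "integrable M (\<lambda>x. \<integral>y. norm (case (x, y) of (x, y) \<Rightarrow> u x * h y) \<partial>N)"
      using u_int by (simp add: abs_mult)
  qed (use h in auto)
  show "(\<integral>z. (\<lambda>(x, y). u x * h y) z \<partial>(M \<Otimes>\<^sub>M N)) = (\<integral>x. u x \<partial>M) * (\<integral>y. h y \<partial>N)"
    using integral_fst'[OF int] by simp
qed

section \<open>Highest bids, deviating bids and the spaces of profiles\<close>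

definition highest_bid :: "auction \<Rightarrow> nat \<Rightarrow> (nat \<Rightarrow> nat \<Rightarrow> real) \<Rightarrow> real" where
  "highest_bid I j a = Max ((\<lambda>l. a l j) ` {..<bidders I})"

text \<open>The restriction makes the bid extensional, as points of the product space
  \<open>action_space I\<close> are; elements of \<open>S\<close> that are not items are
  ignored.\<close>

definition flat_bid :: "auction \<Rightarrow> real \<Rightarrow> nat set \<Rightarrow> nat \<Rightarrow> real" where
  "flat_bid I \<beta> S = (\<lambda>j\<in>{..<items I}. if j \<in> S then \<beta> else 0)"

lemma space_action_space: "space (action_space I) = {..<items I} \<rightarrow>\<^sub>E {0..}"
  by (simp add: action_space_def space_PiM space_restrict_space)

lemma space_profile_space: "space (profile_space I K) = K \<rightarrow>\<^sub>E ({..<items I} \<rightarrow>\<^sub>E {0..})"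
  by (simp add: profile_space_def space_PiM space_action_space)

lemma bid_nonneg:
  assumes "a \<in> space (profile_space I K)" "l \<in> K" "j < items I"
  shows "0 \<le> a l j"
proof -
  have "a l \<in> {..<items I} \<rightarrow>\<^sub>E {0..}"
    using assms(1,2) unfolding space_profile_space by (rule PiE_mem)
  then have "a l j \<in> {0..}" by (rule PiE_mem) (simp add: assms(3))
  then show ?thesis by simp
qed

lemma measurable_bid:
  assumes "l \<in> K" "j < items I"
  shows "(\<lambda>a. a l j) \<in> borel_measurable (profile_space I K)"
proof -
  have "(\<lambda>a. a l) \<in> profile_space I K \<rightarrow>\<^sub>M action_space I"
    using assms(1) unfolding profile_space_def by (rule measurable_component_singleton)
  moreover have "(\<lambda>b. b j) \<in> action_space I \<rightarrow>\<^sub>M restrict_space borel {0::real..}"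
    using assms(2) unfolding action_space_def by (intro measurable_component_singleton) simp
  moreover have "(\<lambda>x. x) \<in> restrict_space borel {0::real..} \<rightarrow>\<^sub>M borel"
    by (intro measurable_restrict_space1) simp
  ultimately show ?thesis by (rule measurable_compose[OF measurable_compose])
qed

lemma flat_bid_in_space: "0 \<le> \<beta> \<Longrightarrow> flat_bid I \<beta> S \<in> space (action_space I)"
  by (auto simp: flat_bid_def space_action_space)

lemma won_subset: "won I i a \<subseteq> {..<items I}" by (auto simp: won_def)

lemma finite_won [simp]: "finite (won I i a)"
  by (rule finite_subset[OF won_subset]) simp

section \<open>Elementary facts on a fixed auction\<close>

locale auction_instance =
  fixes I :: auction
  assumes auction: "second_price_auction I"
begin

abbreviation "n \<equiv> bidders I"
abbreviation "m \<equiv> items I"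
abbreviation "P \<equiv> profile_space I {..<bidders I}"

lemma n_ge_2: "2 \<le> n" using auction by (simp add: second_price_auction_def)

lemma others_nonempty: "{..<n} - {i} \<noteq> {}"
proof -
  have "(if i = 0 then 1 else 0) \<in> {..<n} - {i}" using n_ge_2 by auto
  then show ?thesis by blast
qed

lemma budget_pos: "i < n \<Longrightarrow> 0 < budget I i"
  using auction by (simp add: second_price_auction_def)

lemma val_nonneg: "i < n \<Longrightarrow> S \<subseteq> {..<m} \<Longrightarrow> 0 \<le> val I i S"
  using auction by (simp add: second_price_auction_def monotone_valuation_def)

lemma val_mono: "i < n \<Longrightarrow> T \<subseteq> {..<m} \<Longrightarrow> S \<subseteq> T \<Longrightarrow> val I i S \<le> val I i T"
  using auction by (auto simp: second_price_auction_def monotone_valuation_def mono_on_def)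

lemma bid_le_highest: "l < n \<Longrightarrow> a l j \<le> highest_bid I j a"
  unfolding highest_bid_def by (intro Max_ge) auto

lemma highest_bid_nonneg: "a \<in> space P \<Longrightarrow> j < m \<Longrightarrow> 0 \<le> highest_bid I j a"
  using bid_nonneg[of a I "{..<n}" 0 j] bid_le_highest[of 0 a j] n_ge_2 by auto

lemma measurable_highest_bid: "j < m \<Longrightarrow> highest_bid I j \<in> borel_measurable P"
  unfolding highest_bid_def[abs_def] by (intro borel_measurable_Max measurable_bid) auto

section \<open>Measurability of allocations and payments, bounds on payments\<close>

lemma measurable_won_mem:
  assumes "i < n" shows "Measurable.pred P (\<lambda>a. j \<in> won I i a)"
proof (cases "j < m")
  case True
  have "Measurable.pred P (\<lambda>a. a l j < a i j \<or> (a l j = a i j \<and> (i, l) \<in> tie I))" if "l < n" for l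
  proof -
    have *: "Measurable.pred P (\<lambda>a. f a < g a \<or> (f a = g a \<and> c))"
      if [measurable]: "f \<in> borel_measurable P" "g \<in> borel_measurable P" for f g :: "_ \<Rightarrow> real" and c
    proof -
      \<comment> \<open>Once \<open>f a < g a\<close> fails, \<open>\<not> g a < f a\<close> means
        equality, so strict comparisons suffice.\<close>
      have "Measurable.pred P (\<lambda>a. f a < g a \<or> (\<not> g a < f a \<and> c))" by measurable
      moreover have "f a < g a \<or> (\<not> g a < f a \<and> c) \<longleftrightarrow> f a < g a \<or> (f a = g a \<and> c)" for a by auto
      ultimately show ?thesis by simp
    qed
    show ?thesis using that True assms by (intro * measurable_bid) auto
  qed
  then have "Measurable.pred P
     (\<lambda>a. \<forall>l\<in>{..<n}. a l j < a i j \<or> (a l j = a i j \<and> (i, l) \<in> tie I))"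
    by (intro pred_intros_finite) auto
  moreover have "j \<in> won I i a \<longleftrightarrow>
      (\<forall>l\<in>{..<n}. a l j < a i j \<or> (a l j = a i j \<and> (i, l) \<in> tie I))" for a
    using True by (auto simp: won_def)
  ultimately show ?thesis by (simp only:)
next
  case False
  then have "(\<lambda>a. j \<in> won I i a) = (\<lambda>a. False)" by (simp add: won_def)
  then show ?thesis by simp
qed

text \<open>The target is finite and discrete, so it is enough that each fibre is a finite
  combination of membership events. Every function of the won set, such as its value, is then
  measurable.\<close>

lemma measurable_won:
  assumes i: "i < n" shows "won I i \<in> P \<rightarrow>\<^sub>M count_space (Pow {..<m})"
proof (rule measurable_count_space_eq2[THEN iffD2], simp, intro conjI ballI)
  show "won I i \<in> space P \<rightarrow> Pow {..<m}" by (auto simp: won_def)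
next
  fix S assume S: "S \<in> Pow {..<m}"
  have "won I i a = S \<longleftrightarrow> (\<forall>j\<in>{..<m}. j \<in> won I i a \<longleftrightarrow> j \<in> S)" for a
    using S won_subset[of I i a] by blast
  then have "won I i -` {S} \<inter> space P = {a \<in> space P. \<forall>j\<in>{..<m}. j \<in> won I i a \<longleftrightarrow> j \<in> S}"
    by auto
  also have "\<dots> \<in> sets P"
  proof -
    have [measurable]: "Measurable.pred P (\<lambda>a. j \<in> won I i a)" for j
      by (rule measurable_won_mem[OF i])
    have "Measurable.pred P (\<lambda>a. \<forall>j\<in>{..<m}. j \<in> won I i a \<longleftrightarrow> j \<in> S)" by measurable
    then show ?thesis by simp
  qed
  finally show "won I i -` {S} \<inter> space P \<in> sets P" .
qed

lemma measurable_val_won: "i < n \<Longrightarrow> (\<lambda>a. val I i (won I i a)) \<in> borel_measurable P"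
  by (rule measurable_compose[OF measurable_won]) auto

lemma measurable_payment:
  assumes "i < n" shows "payment I i \<in> borel_measurable P"
proof -
  have [measurable]: "Measurable.pred P (\<lambda>a. j \<in> won I i a)" for j
    by (rule measurable_won_mem[OF assms])
  have [measurable]: "(\<lambda>a. Max ((\<lambda>l. a l j) ` ({..<n} - {i}))) \<in> borel_measurable P" if "j \<in> {..<m}" for j
    using that by (intro borel_measurable_Max measurable_bid) auto
  \<comment> \<open>The index set \<open>won I i a\<close> varies with \<open>a\<close>; a
    conditional summand over all items has a fixed index set.\<close>
  have "payment I i a =
      (\<Sum>j\<in>{..<m}. if j \<in> won I i a then Max ((\<lambda>l. a l j) ` ({..<n} - {i})) else 0)" for a
    unfolding payment_def using won_subset[of I i a]
    by (subst sum.inter_restrict[symmetric]) (auto simp: Int_absorb1)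
  then have "payment I i =
      (\<lambda>a. \<Sum>j\<in>{..<m}. if j \<in> won I i a then Max ((\<lambda>l. a l j) ` ({..<n} - {i})) else 0)" by auto
  also have "\<dots> \<in> borel_measurable P" by measurable
  finally show ?thesis .
qed

lemma measurable_utility: "i < n \<Longrightarrow> utility I i \<in> borel_measurable P"
  unfolding utility_def[abs_def]
  using measurable_payment measurable_val_won by (intro borel_measurable_diff) auto

text \<open>Including bidder \<open>i\<close> in the maximum gives one price bound per item that is
  common to all deviators, so that the bounds can later be summed over bidders.\<close>

lemma others_max_le_highest: "Max ((\<lambda>l. a l j) ` ({..<n} - {i})) \<le> highest_bid I j a"
  unfolding highest_bid_def using others_nonempty by (intro Max_mono) auto

lemma payment_nonneg:
  assumes "a \<in> space P" shows "0 \<le> payment I i a"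
  unfolding payment_def
proof (intro sum_nonneg)
  fix j assume "j \<in> won I i a"
  then have j: "j < m" using won_subset by blast
  obtain l where l: "l \<in> {..<n} - {i}" using others_nonempty by blast
  have "0 \<le> a l j" using bid_nonneg[OF assms] l j by auto
  also have "\<dots> \<le> Max ((\<lambda>l. a l j) ` ({..<n} - {i}))" using l by (intro Max_ge) auto
  finally show "0 \<le> Max ((\<lambda>l. a l j) ` ({..<n} - {i}))" .
qed

lemma payment_le_sum_highest:
  assumes "a \<in> space P" shows "payment I i a \<le> (\<Sum>j<m. highest_bid I j a)"
proof -
  have "payment I i a \<le> (\<Sum>j\<in>won I i a. highest_bid I j a)"
    unfolding payment_def by (intro sum_mono others_max_le_highest)
  also have "\<dots> \<le> (\<Sum>j<m. highest_bid I j a)"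
    using won_subset highest_bid_nonneg[OF assms] by (intro sum_mono2) auto
  finally show ?thesis .
qed

section \<open>Cost and outcome of a flat bid\<close>

lemma flat_bid_payment:
  assumes a: "a \<in> space P" and i: "i < n"
  shows "payment I i (a(i := flat_bid I \<beta> S)) \<le> (\<Sum>j<m. indicator {S. j \<in> S} S * highest_bid I j a)"
proof -
  let ?a = "a(i := flat_bid I \<beta> S)"
  \<comment> \<open>This bound is free of \<open>\<beta>\<close>, and each summand splits into a
    factor in \<open>S\<close> and a factor in \<open>a\<close>, which independence separates
    later.\<close>
  have "payment I i ?a \<le> (\<Sum>j\<in>won I i ?a. indicator {S. j \<in> S} S * highest_bid I j a)"
    unfolding payment_def
  proof (intro sum_mono)
    fix j assume j: "j \<in> won I i ?a"
    have eq: "(\<lambda>l. ?a l j) ` ({..<n} - {i}) = (\<lambda>l. a l j) ` ({..<n} - {i})" by auto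
    show "Max ((\<lambda>l. ?a l j) ` ({..<n} - {i})) \<le> indicator {S. j \<in> S} S * highest_bid I j a"
    proof (cases "j \<in> S")
      case True
      then show ?thesis using others_max_le_highest by (simp add: eq del: fun_upd_apply)
    next
      case False
      \<comment> \<open>An item outside \<open>S\<close> is won with bid \<open>0\<close>, so no
        other bid on it is positive and it costs nothing.\<close>
      have "?a i j = 0" using j won_subset False by (auto simp: flat_bid_def)
      then have "?a l j \<le> 0" if "l < n" for l using j that by (auto simp: won_def simp del: fun_upd_apply)
      then show ?thesis using False others_nonempty by (subst Max_le_iff[THEN iffD2]) (auto simp del: fun_upd_apply)
    qed
  qed
  also have "\<dots> \<le> (\<Sum>j<m. indicator {S. j \<in> S} S * highest_bid I j a)"
    using won_subset highest_bid_nonneg[OF a] by (intro sum_mono2) auto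
  finally show ?thesis .
qed

lemma tie_refl: "i < n \<Longrightarrow> (i, i) \<in> tie I"
  using auction
  by (auto simp: second_price_auction_def linear_order_on_def partial_order_on_def
      preorder_on_def refl_on_def)

text \<open>All competing bids are strictly below \<open>\<beta>\<close>, so the tie rule is
  consulted only for \<open>i\<close> against itself.\<close>

lemma flat_bid_won:
  assumes "i < n" "\<forall>j<m. highest_bid I j a < \<beta>"
  shows "S \<inter> {..<m} \<subseteq> won I i (a(i := flat_bid I \<beta> S))"
proof
  fix j assume j: "j \<in> S \<inter> {..<m}"
  have "a l j < \<beta>" if "l < n" for l
    using assms(2) j bid_le_highest[OF that, of a j] by force
  moreover note tie_refl[OF assms(1)]
  ultimately show "j \<in> won I i (a(i := flat_bid I \<beta> S))"
    using j by (auto simp: won_def flat_bid_def)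
qed

section \<open>Maximal payments and their sum\<close>

lemma won_mem_cong:
  assumes "i < n" "\<And>l. l < n \<Longrightarrow> j < m \<Longrightarrow> a l j = b l j"
  shows "j \<in> won I i a \<longleftrightarrow> j \<in> won I i b"
  using assms by (auto simp: won_def)

lemma bid_le_winning: "j \<in> won I i a \<Longrightarrow> l < n \<Longrightarrow> a l j \<le> a i j"
  by (auto simp: won_def)

lemma highest_bid_won:
  assumes "i < n" "j \<in> won I i a" shows "highest_bid I j a = a i j"
  unfolding highest_bid_def using assms bid_le_winning[OF assms(2)] by (intro Max_eqI) auto

text \<open>Scaling the others' bids on the items won by \<open>i\<close> to just below \<open>i\<close>'s own bids
  preserves the allocation, even when ties would be resolved against \<open>i\<close>.\<close>

lemma maximal_payment_eq:
  assumes a: "a \<in> space P" and i: "i < n"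
  shows "maximal_payment I i a = (\<Sum>j\<in>won I i a. a i j)"
proof -
  let ?N = "{..<n} - {i}"
  let ?X = "{payment I i (a'(i := a i)) | a'.
            a' \<in> space (profile_space I ?N) \<and> won I i (a'(i := a i)) = won I i a}"
  \<comment> \<open>The allocation is kept, so \<open>i\<close> still wins these items and no
    competing bid on them exceeds its own.\<close>
  have le: "x \<le> (\<Sum>j\<in>won I i a. a i j)" if x: "x \<in> ?X" for x
  proof -
    obtain a' where x': "x = payment I i (a'(i := a i))"
      and w: "won I i (a'(i := a i)) = won I i a" using x by blast
    show ?thesis unfolding x' payment_def w
    proof (intro sum_mono)
      fix j assume "j \<in> won I i a"
      then have "j \<in> won I i (a'(i := a i))" by (simp add: w)
      from bid_le_winning[OF this]
      show "Max ((\<lambda>l. (a'(i := a i)) l j) ` ?N) \<le> a i j"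
        using others_nonempty by (subst Max_le_iff) force+
    qed
  qed
  have ge: "t * (\<Sum>j\<in>won I i a. a i j) \<in> ?X" if t: "0 < t" "t < 1" for t
  proof -
    \<comment> \<open>Bids on the items lost by \<open>i\<close> are unchanged, so these stay lost;
      on the others every opponent bids \<open>t * a i j\<close>, which becomes the price.\<close>
    define a' where "a' = (\<lambda>l\<in>?N. \<lambda>j\<in>{..<m}. if j \<in> won I i a then t * a i j else a l j)"
    have a': "a' \<in> space (profile_space I ?N)"
      using bid_nonneg[OF a] t i unfolding a'_def space_profile_space
      by (intro restrict_PiE_iff[THEN iffD2] ballI) auto
    have bid: "(a'(i := a i)) l j = (if l = i then a i j else if j \<in> won I i a then t * a i j else a l j)"
      if "l < n" "j < m" for l j using that by (simp add: a'_def)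
    have w: "j \<in> won I i (a'(i := a i)) \<longleftrightarrow> j \<in> won I i a" for j
    proof (cases "j \<in> won I i a")
      case True
      then have j: "j < m" using won_subset by blast
      have "(a'(i := a i)) l j < a i j \<or> (a'(i := a i)) l j = a i j \<and> (i, l) \<in> tie I"
        if l: "l < n" for l
      proof (cases "a i j = 0 \<or> l = i")
        case False
        then have "0 < a i j" using bid_nonneg[OF a _ j, of i] i by simp
        then show ?thesis using t False True by (simp add: bid[OF l j] del: fun_upd_apply)
      next
        case zero: True
        \<comment> \<open>For \<open>a i j = 0\<close> the scaled bid still ties. But then
          \<open>l\<close> already bid \<open>0\<close> in \<open>a\<close>, where \<open>i\<close>
          won, so the tie rule favours \<open>i\<close> against \<open>l\<close>.\<close>
        have "a i j = 0 \<Longrightarrow> a l j = a i j"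
          using bid_le_winning[OF True l] bid_nonneg[OF a _ j, of l] l by simp
        then have "a i j = 0 \<Longrightarrow> (i, l) \<in> tie I" using True l by (auto simp: won_def)
        then show ?thesis using zero True tie_refl[OF i] by (auto simp: bid[OF l j] simp del: fun_upd_apply)
      qed
      then show ?thesis using True j by (simp add: won_def)
    next
      case False
      then show ?thesis using bid by (intro won_mem_cong[OF i]) simp
    qed
    then have w: "won I i (a'(i := a i)) = won I i a" by blast
    have "payment I i (a'(i := a i)) = (\<Sum>j\<in>won I i a. t * a i j)"
      unfolding payment_def w
    proof (intro sum.cong refl)
      fix j assume j: "j \<in> won I i a"
      then have "j < m" using won_subset by blast
      then have "(\<lambda>l. (a'(i := a i)) l j) ` ?N = (\<lambda>l. t * a i j) ` ?N"
        using bid[of _ j] j by (intro image_cong refl) (simp del: fun_upd_apply)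
      then show "Max ((\<lambda>l. (a'(i := a i)) l j) ` ?N) = t * a i j"
        using others_nonempty by (simp add: image_constant_conv)
    qed
    then show ?thesis using a' w by (auto simp: sum_distrib_left intro!: exI[of _ a'])
  qed
  have "Sup ?X \<le> (\<Sum>j\<in>won I i a. a i j)"
  proof (rule cSup_least)
    show "?X \<noteq> {}" using ge[of "1/2"] by auto
  qed (use le in blast)
  \<comment> \<open>The supremum need not be attained, so it is approached through all
    \<open>t\<close> below 1.\<close>
  moreover have "(\<Sum>j\<in>won I i a. a i j) \<le> Sup ?X"
  proof (rule field_le_mult_one_interval)
    fix t :: real assume "0 < t" "t < 1"
    from ge[OF this] show "t * (\<Sum>j\<in>won I i a. a i j) \<le> Sup ?X"
      by (rule cSup_upper) (use le in \<open>auto simp: bdd_above_def\<close>)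
  qed
  ultimately show ?thesis unfolding maximal_payment_def by simp
qed

lemma maximal_payment_nonneg: "a \<in> space P \<Longrightarrow> i < n \<Longrightarrow> 0 \<le> maximal_payment I i a"
  using bid_nonneg[of a I "{..<n}" i] won_subset[of I i a]
  by (auto simp: maximal_payment_eq intro!: sum_nonneg)

lemma measurable_maximal_payment:
  assumes "i < n" shows "maximal_payment I i \<in> borel_measurable P"
proof -
  have [measurable]: "Measurable.pred P (\<lambda>a. j \<in> won I i a)" for j
    by (rule measurable_won_mem[OF assms])
  have [measurable]: "(\<lambda>a. a i j) \<in> borel_measurable P" if "j \<in> {..<m}" for j
    using that assms by (intro measurable_bid) auto
  have "maximal_payment I i a = (\<Sum>j\<in>{..<m}. if j \<in> won I i a then a i j else 0)"
    if "a \<in> space P" for a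
    unfolding maximal_payment_eq[OF that assms] using won_subset[of I i a]
    by (subst sum.inter_restrict[symmetric]) (auto simp: Int_absorb1)
  then show ?thesis
    by (subst measurable_cong[where g = "\<lambda>a. \<Sum>j\<in>{..<m}. if j \<in> won I i a then a i j else 0"]) simp_all
qed

text \<open>Every item has exactly one winner, whose bid on it is the highest, so the winning bids
  run once through the items. This turns no overbidding into a bound on expected highest
  bids.\<close>

lemma sum_maximal_payment:
  assumes "a \<in> space P"
  shows "(\<Sum>i<n. maximal_payment I i a) = (\<Sum>j<m. highest_bid I j a)"
proof -
  have "(\<Sum>i<n. maximal_payment I i a) = (\<Sum>i<n. \<Sum>j\<in>won I i a. highest_bid I j a)"
    using assms by (intro sum.cong refl) (auto simp: maximal_payment_eq highest_bid_won)
  also have "\<dots> = (\<Sum>j\<in>(\<Union>i<n. won I i a). highest_bid I j a)"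
    using won_by_exactly_one[OF auction] won_subset
    by (intro sum.UNION_disjoint[symmetric]) (auto, blast)
  also have "(\<Union>i<n. won I i a) = {..<m}"
    using won_by_exactly_one[OF auction] won_subset by fast
  finally show ?thesis .
qed

end

section \<open>Random profiles and deviations from them\<close>

locale auction_distribution = auction_instance +
  fixes A :: "(nat \<Rightarrow> nat \<Rightarrow> real) measure"
  assumes A: "A \<in> space (prob_algebra (profile_space I {..<bidders I}))"
begin

sublocale prob_space A
  using A by (simp add: space_prob_algebra)

lemma sets_A [measurable_cong]: "sets A = sets P"
  using A by (simp add: space_prob_algebra)

lemma space_A: "space A = space P"
  by (rule sets_eq_imp_space_eq[OF sets_A])

lemma measurable_A: "measurable A N = measurable P N"
  by (rule measurable_cong_sets[OF sets_A refl])

lemma integrable_val_won: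
  assumes "i < n" shows "integrable A (\<lambda>a. val I i (won I i a))"
proof (rule integrable_const_bound[of _ "val I i {..<m}"])
  show "AE a in A. norm (val I i (won I i a)) \<le> val I i {..<m}"
    using val_nonneg[OF assms won_subset] val_mono[OF assms _ won_subset] by simp
qed (use measurable_val_won[OF assms] in \<open>simp add: measurable_A\<close>)

text \<open>A product of image measures is an image of the product, so the others' bids can be drawn
  from all of \<open>A\<close> instead of its marginal. Keeping the overwritten coordinate
  \<open>i\<close> allows comparison with \<open>highest_bid I j a\<close>.\<close>

lemma deviation_expectation_flat:
  assumes i: "i < n" and \<beta>: "0 \<le> \<beta>" and f: "f \<in> borel_measurable P"
  shows "deviation_expectation I i (distr (measure_pmf q) (action_space I) (flat_bid I \<beta>)) A f =
    ext_expectation (measure_pmf q \<Otimes>\<^sub>M A) (\<lambda>(S, a). f (a(i := flat_bid I \<beta> S)))"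
proof -
  let ?O = "profile_space I ({..<n} - {i})" and ?r = "\<lambda>a. restrict a ({..<n} - {i})"
  have T [measurable]: "flat_bid I \<beta> \<in> measure_pmf q \<rightarrow>\<^sub>M action_space I"
    using flat_bid_in_space[OF \<beta>] by simp
  have r [measurable]: "?r \<in> A \<rightarrow>\<^sub>M ?O"
    unfolding measurable_A profile_space_def by (intro measurable_restrict_subset) auto
  interpret r: prob_space "distr A ?O ?r" by (rule prob_space_distr[OF r])
  have pair: "distr (measure_pmf q) (action_space I) (flat_bid I \<beta>) \<Otimes>\<^sub>M distr A ?O ?r =
     distr (measure_pmf q \<Otimes>\<^sub>M A) (action_space I \<Otimes>\<^sub>M ?O) (\<lambda>(S, a). (flat_bid I \<beta> S, ?r a))"
    by (rule pair_measure_distr[OF T r]) unfold_locales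
  have "(\<lambda>(a, b). a(i := b)) \<in> ?O \<Otimes>\<^sub>M action_space I \<rightarrow>\<^sub>M profile_space I (insert i ({..<n} - {i}))"
    unfolding profile_space_def by (rule measurable_add_dim)
  also have "insert i ({..<n} - {i}) = {..<n}" using i by auto
  finally have "(\<lambda>p. (\<lambda>(a, b). a(i := b)) (snd p, fst p)) \<in> action_space I \<Otimes>\<^sub>M ?O \<rightarrow>\<^sub>M P"
    by (rule measurable_compose[rotated]) measurable
  then have "(\<lambda>p. f ((\<lambda>(a, b). a(i := b)) (snd p, fst p))) \<in> borel_measurable (action_space I \<Otimes>\<^sub>M ?O)"
    by (rule measurable_compose[OF _ f])
  then have g: "(\<lambda>(b, a). f (a(i := b))) \<in> borel_measurable (action_space I \<Otimes>\<^sub>M ?O)"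
    by (simp add: case_prod_beta')
  have "deviation_expectation I i (distr (measure_pmf q) (action_space I) (flat_bid I \<beta>)) A f =
     ext_expectation (measure_pmf q \<Otimes>\<^sub>M A)
       (\<lambda>x. (\<lambda>(b, a). f (a(i := b))) ((\<lambda>(S, a). (flat_bid I \<beta> S, ?r a)) x))"
    unfolding deviation_expectation_def marginal_others_def pair
    by (rule ext_expectation_distr[OF _ g]) measurable
  also have "\<dots> = ext_expectation (measure_pmf q \<Otimes>\<^sub>M A) (\<lambda>(S, a). f (a(i := flat_bid I \<beta> S)))"
  proof (rule ext_expectation_cong)
    fix x assume "x \<in> space (measure_pmf q \<Otimes>\<^sub>M A)"
    then obtain S a where x: "x = (S, a)" and a: "a \<in> space P"
      by (auto simp: space_pair_measure space_A)
    \<comment> \<open>As \<open>a\<close> is extensional, the restriction alters only coordinate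
      \<open>i\<close>, which the update overwrites.\<close>
    have "(?r a)(i := b) = a(i := b)" for b
      using a by (auto simp: fun_eq_iff space_profile_space PiE_def extensional_def)
    then show "(\<lambda>(b, a). f (a(i := b))) ((\<lambda>(S, a). (flat_bid I \<beta> S, ?r a)) x) =
        (\<lambda>(S, a). f (a(i := flat_bid I \<beta> S))) x" by (simp add: x)
  qed
  finally show ?thesis .
qed

lemma measurable_flat_deviation:
  assumes i: "i < n" and \<beta>: "0 \<le> \<beta>"
  shows "(\<lambda>(S, a). a(i := flat_bid I \<beta> S)) \<in> measure_pmf q \<Otimes>\<^sub>M A \<rightarrow>\<^sub>M P"
proof -
  have [measurable]: "flat_bid I \<beta> \<in> measure_pmf q \<rightarrow>\<^sub>M action_space I"
    using flat_bid_in_space[OF \<beta>] by simp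
  have [measurable]: "(\<lambda>a. a) \<in> A \<rightarrow>\<^sub>M P" by (simp add: measurable_A)
  have "(\<lambda>(a, b). a(i := b)) \<in> P \<Otimes>\<^sub>M action_space I \<rightarrow>\<^sub>M profile_space I (insert i {..<n})"
    unfolding profile_space_def by (rule measurable_add_dim)
  also have "insert i {..<n} = {..<n}" using i by auto
  finally have "(\<lambda>p. (\<lambda>(a, b). a(i := b)) (snd p, flat_bid I \<beta> (fst p))) \<in> measure_pmf q \<Otimes>\<^sub>M A \<rightarrow>\<^sub>M P"
    by (rule measurable_compose[rotated]) measurable
  then show ?thesis by (simp only: case_prod_beta' fst_conv snd_conv)
qed

text \<open>A profile has finitely many real bids, so these increasing events exhaust the
  space.\<close>

lemma tendsto_prob_highest_bids_less:
  "(\<lambda>k. prob {a \<in> space A. \<forall>j<m. highest_bid I j a < real k}) \<longlonglongrightarrow> 1"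
proof -
  let ?G = "\<lambda>k. {a \<in> space A. \<forall>j\<in>{..<m}. highest_bid I j a < real k}"
  have [measurable]: "highest_bid I j \<in> borel_measurable A" if "j \<in> {..<m}" for j
    using measurable_highest_bid that by (simp add: measurable_A)
  have "(\<lambda>k. prob (?G k)) \<longlonglongrightarrow> prob (\<Union>k. ?G k)"
  proof (rule finite_Lim_measure_incseq)
    show "range ?G \<subseteq> events" by auto
    show "incseq ?G" by (force simp: incseq_def)
  qed
  also have "(\<Union>k. ?G k) = space A"
  proof (intro equalityI subsetI)
    fix a assume a: "a \<in> space A"
    obtain k where "Max (insert 0 ((\<lambda>j. highest_bid I j a) ` {..<m})) < real k"
      using reals_Archimedean2 by blast
    then show "a \<in> (\<Union>k. ?G k)" using a by auto
  qed auto
  finally show ?thesis by (simp add: prob_space Ball_def)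
qed

text \<open>Bidder \<open>i\<close> bids a large amount \<open>k\<close> on a random set of items drawn from \<open>q\<close>.\<close>

lemma equilibrium_deviation_bound:
  assumes cce: "coarse_correlated_equilibrium I A" and i: "i < n"
    and h: "\<And>j. j < m \<Longrightarrow> integrable A (highest_bid I j)"
    and Q: "Q = (\<Sum>j<m. measure_pmf.prob q {S. j \<in> S} * (\<integral>a. highest_bid I j a \<partial>A))"
    and budget: "ereal Q \<le> budget I i"
  shows "(\<integral>S. val I i (S \<inter> {..<m}) \<partial>measure_pmf q) - Q \<le> (\<integral>a. val I i (won I i a) \<partial>A)"
proof -
  let ?R = "measure_pmf q \<Otimes>\<^sub>M A"
  \<comment> \<open>\<open>q\<close> may charge sets with non-items, whereas values are controlled
    only on subsets of \<open>{..<m}\<close>.\<close>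
  let ?v = "\<lambda>S. val I i (S \<inter> {..<m})"
  define G where "G k = {a \<in> space A. \<forall>j<m. highest_bid I j a < real k}" for k
  interpret R: prob_space ?R
    by (intro prob_space_pair prob_space_axioms measure_pmf.prob_space_axioms)
  note indep = integral_mult_independent[OF measure_pmf.prob_space_axioms prob_space_axioms]
  define g :: "nat \<Rightarrow> nat set \<times> (nat \<Rightarrow> nat \<Rightarrow> real) \<Rightarrow> real"
    where "g j = (\<lambda>(S, a). indicator {S. j \<in> S} S * highest_bid I j a)" for j
  have g: "integrable ?R (g j)"
    "(\<integral>z. g j z \<partial>?R) = measure_pmf.prob q {S. j \<in> S} * (\<integral>a. highest_bid I j a \<partial>A)" if "j < m" for j
    using indep[of "indicator {S. j \<in> S}" q 1 "highest_bid I j"] h[OF that]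
    by (auto simp: g_def)
  let ?H = "\<lambda>z. \<Sum>j<m. g j z"
  have H: "integrable ?R ?H" "(\<integral>z. ?H z \<partial>?R) = Q"
    by (auto simp: Q g intro!: Bochner_Integration.integrable_sum)
  \<comment> \<open>Payments are dominated by the sum of the highest bids, hence integrable, and
    dropping their nonnegative mean only increases the utility.\<close>
  have eq_utility: "ext_expectation A (utility I i) \<le> ereal (\<integral>a. val I i (won I i a) \<partial>A)"
  proof -
    have "integrable A (payment I i)"
    proof (rule Bochner_Integration.integrable_bound)
      show "integrable A (\<lambda>a. \<Sum>j<m. highest_bid I j a)" using h by auto
      show "payment I i \<in> borel_measurable A" using measurable_payment[OF i] by (simp add: measurable_A)
      show "AE a in A. norm (payment I i a) \<le> norm (\<Sum>j<m. highest_bid I j a)"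
      proof (rule AE_I2)
        fix a assume "a \<in> space A"
        then have "a \<in> space P" by (simp add: space_A)
        from payment_nonneg[OF this, of i] payment_le_sum_highest[OF this, of i]
        show "norm (payment I i a) \<le> norm (\<Sum>j<m. highest_bid I j a)" by simp
      qed
    qed
    moreover have "0 \<le> (\<integral>a. payment I i a \<partial>A)"
      by (intro integral_nonneg_AE AE_I2 payment_nonneg) (simp add: space_A)
    ultimately show ?thesis
      using integrable_val_won[OF i] by (simp add: utility_def[abs_def] ext_expectation_integrable)
  qed
  have bound: "(\<integral>S. ?v S \<partial>measure_pmf q) * prob (G k) - Q \<le> (\<integral>a. val I i (won I i a) \<partial>A)" for k
  proof -
    let ?D = "distr (measure_pmf q) (action_space I) (flat_bid I (real k))"
    let ?d = "\<lambda>(S, a). a(i := flat_bid I (real k) S)"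
    have d: "?d \<in> ?R \<rightarrow>\<^sub>M P" by (rule measurable_flat_deviation[OF i]) simp
    have d_space: "?d z \<in> space P" if "z \<in> space ?R" for z
      using measurable_space[OF d that] .
    let ?pay = "\<lambda>z. payment I i (?d z)" and ?val = "\<lambda>z. val I i (won I i (?d z))"
    have pay_le: "?pay z \<le> ?H z" if sp: "z \<in> space ?R" for z
    proof -
      obtain S a where z: "z = (S, a)" "a \<in> space P"
        using sp by (auto simp: space_pair_measure space_A)
      show ?thesis using flat_bid_payment[OF z(2) i, of "real k" S] by (simp add: z(1) g_def del: fun_upd_apply)
    qed
    have pay_int: "integrable ?R ?pay"
    proof (rule Bochner_Integration.integrable_bound[OF H(1)])
      show "?pay \<in> borel_measurable ?R" by (rule measurable_compose[OF d measurable_payment[OF i]])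
      show "AE z in ?R. norm (?pay z) \<le> norm (?H z)"
      proof (rule AE_I2)
        fix z assume z: "z \<in> space ?R"
        from payment_nonneg[OF d_space[OF z], of i] pay_le[OF z]
        show "norm (?pay z) \<le> norm (?H z)" unfolding real_norm_def by linarith
      qed
    qed
    have pay_Q: "(\<integral>z. ?pay z \<partial>?R) \<le> Q"
      unfolding H(2)[symmetric] by (intro integral_mono pay_int H(1) pay_le)
    have val_int: "integrable ?R ?val"
    proof (rule R.integrable_const_bound[of _ "val I i {..<m}"])
      show "AE z in ?R. norm (?val z) \<le> val I i {..<m}"
        using val_nonneg[OF i won_subset] val_mono[OF i _ won_subset] by simp
      show "?val \<in> borel_measurable ?R" by (rule measurable_compose[OF d measurable_val_won[OF i]])
    qed
    have G: "G k \<in> events"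
    proof -
      have [measurable]: "highest_bid I j \<in> borel_measurable A" if "j \<in> {..<m}" for j
        using h that by auto
      have "{a \<in> space A. \<forall>j\<in>{..<m}. highest_bid I j a < real k} \<in> events" by measurable
      then show ?thesis by (simp add: G_def Ball_def)
    qed
    have v_bound: "\<bar>?v S\<bar> \<le> val I i {..<m}" for S
      using val_nonneg[OF i, of "S \<inter> {..<m}"] val_mono[OF i, of "{..<m}" "S \<inter> {..<m}"] by simp
    have vG: "integrable ?R (\<lambda>(S, a). ?v S * indicator (G k) a)"
      "(\<integral>z. (\<lambda>(S, a). ?v S * indicator (G k) a) z \<partial>?R) = (\<integral>S. ?v S \<partial>measure_pmf q) * prob (G k)"
      using indep[of ?v q "val I i {..<m}" "indicator (G k)"] v_bound G
      by (auto simp: less_top[symmetric])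
    \<comment> \<open>On \<open>G k\<close> the deviator outbids everyone and wins all items of
      \<open>S\<close>; elsewhere nonnegativity of values suffices.\<close>
    have "(\<integral>z. (\<lambda>(S, a). ?v S * indicator (G k) a) z \<partial>?R) \<le> (\<integral>z. ?val z \<partial>?R)"
    proof (intro integral_mono vG(1) val_int)
      fix z assume "z \<in> space ?R"
      obtain S a where z: "z = (S, a)" by force
      show "(\<lambda>(S, a). ?v S * indicator (G k) a) z \<le> ?val z"
      proof (cases "a \<in> G k")
        case True
        then have "S \<inter> {..<m} \<subseteq> won I i (?d z)"
          using flat_bid_won[OF i, of a "real k" S] by (simp add: z G_def del: fun_upd_apply)
        from val_mono[OF i won_subset this] show ?thesis using True by (simp add: z del: fun_upd_apply)
      next
        case False
        then show ?thesis using val_nonneg[OF i won_subset] by (simp add: z del: fun_upd_apply)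
      qed
    qed
    then have val_ge: "(\<integral>S. ?v S \<partial>measure_pmf q) * prob (G k) \<le> (\<integral>z. ?val z \<partial>?R)"
      unfolding vG(2) .
    have dev: "deviation_expectation I i ?D A f = ext_expectation ?R (\<lambda>z. f (?d z))"
      if "f \<in> borel_measurable P" for f
      using deviation_expectation_flat[OF i _ that, of "real k" q] by (simp add: case_prod_beta')
    \<comment> \<open>The payment bound \<open>Q\<close> is uniform in \<open>k\<close>, so the
      budget allows arbitrarily large bids.\<close>
    have "deviation_expectation I i ?D A (payment I i) \<le> budget I i"
    proof -
      have "deviation_expectation I i ?D A (payment I i) = ereal (\<integral>z. ?pay z \<partial>?R)"
        unfolding dev[OF measurable_payment[OF i]] by (rule ext_expectation_integrable[OF pay_int])
      also have "\<dots> \<le> ereal Q" using pay_Q by simp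
      finally show ?thesis using budget by (rule order_trans)
    qed
    moreover have "?D \<in> space (prob_algebra (action_space I))"
      using flat_bid_in_space[of "real k" I]
      by (auto simp: space_prob_algebra intro!: measure_pmf.prob_space_distr)
    ultimately have "?D \<in> feasible_deviations I i A" by (simp add: feasible_deviations_def)
    then have eq: "deviation_expectation I i ?D A (utility I i) \<le> ext_expectation A (utility I i)"
      using cce i by (auto simp: coarse_correlated_equilibrium_def)
    have "deviation_expectation I i ?D A (utility I i) =
        ereal ((\<integral>z. ?val z \<partial>?R) - (\<integral>z. ?pay z \<partial>?R))"
      unfolding dev[OF measurable_utility[OF i]] utility_def
      by (subst ext_expectation_integrable) (use val_int pay_int in auto)
    then have "ereal ((\<integral>z. ?val z \<partial>?R) - (\<integral>z. ?pay z \<partial>?R)) \<le> ereal (\<integral>a. val I i (won I i a) \<partial>A)"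
      using order_trans[OF eq eq_utility] by (rule ord_eq_le_trans[OF sym])
    then show ?thesis using val_ge pay_Q by simp
  qed
  \<comment> \<open>As \<open>k\<close> grows, the probability of winning the whole drawn bundle
    tends to 1 while the payment bound stays fixed.\<close>
  have "(\<lambda>k. (\<integral>S. ?v S \<partial>measure_pmf q) * prob (G k) - Q) \<longlonglongrightarrow> (\<integral>S. ?v S \<partial>measure_pmf q) * 1 - Q"
    unfolding G_def by (intro tendsto_intros tendsto_prob_highest_bids_less)
  from LIMSEQ_le_const2[OF this] bound show ?thesis by simp
qed

section \<open>Liquid welfare and no overbidding\<close>

lemma liquid_welfare_eq:
  "liquid_welfare I A = (\<Sum>i<n. min (ereal (\<integral>a. val I i (won I i a) \<partial>A)) (budget I i))"
  unfolding liquid_welfare_def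
  by (intro sum.cong refl) (simp add: ext_expectation_integrable integrable_val_won)

lemma liquid_welfare_nonneg: "0 \<le> liquid_welfare I A"
  unfolding liquid_welfare_eq using budget_pos val_nonneg[OF _ won_subset]
  by (intro sum_nonneg) (auto intro!: integral_nonneg_AE less_imp_le)

text \<open>Budgets may be infinite, so finiteness comes from the expected values instead of the
  caps.\<close>

lemma liquid_welfare_finite: "liquid_welfare I A \<noteq> \<infinity>"
proof -
  have "liquid_welfare I A \<le> (\<Sum>i<n. ereal (\<integral>a. val I i (won I i a) \<partial>A))"
    unfolding liquid_welfare_eq by (intro sum_mono) simp
  then show ?thesis by auto
qed

text \<open>Finite liquid welfare bounds the total expected maximal payment, so each term is finite.
  Pointwise, a single highest bid is at most the sum of all maximal payments, hence integrable;
  integrating that sum gives the second claim.\<close>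

lemma expected_highest_bids:
  assumes "nob_feasible I A"
  shows "j < m \<Longrightarrow> integrable A (highest_bid I j)"
    and "ereal (\<Sum>j<m. \<integral>a. highest_bid I j a \<partial>A) \<le> liquid_welfare I A"
proof -
  have nn: "0 \<le> ext_expectation A (maximal_payment I i)" if "i < n" for i
    using that by (subst ext_expectation_nonneg) (auto simp: space_A maximal_payment_nonneg)
  have le: "(\<Sum>i<n. ext_expectation A (maximal_payment I i)) \<le> liquid_welfare I A"
    using assms by (simp add: nob_feasible_def)
  then have "(\<Sum>i<n. ext_expectation A (maximal_payment I i)) \<noteq> \<infinity>"
    using liquid_welfare_finite by auto
  then have "ext_expectation A (maximal_payment I i) \<noteq> \<infinity>" if "i < n" for i
    using that by (auto simp: sum_Pinfty)
  then have int: "integrable A (maximal_payment I i)" if "i < n" for i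
    using that measurable_maximal_payment maximal_payment_nonneg
    by (intro integrable_if_ext_expectation_finite) (auto simp: measurable_A space_A)
  have int_sum: "integrable A (\<lambda>a. \<Sum>i<n. maximal_payment I i a)"
    using int by (intro Bochner_Integration.integrable_sum) auto
  have h: "integrable A (highest_bid I j)" if j: "j < m" for j
  proof (rule Bochner_Integration.integrable_bound[OF int_sum])
    show "highest_bid I j \<in> borel_measurable A"
      using measurable_highest_bid[OF j] by (simp add: measurable_A)
    show "AE a in A. norm (highest_bid I j a) \<le> norm (\<Sum>i<n. maximal_payment I i a)"
    proof (rule AE_I2)
      fix a assume "a \<in> space A"
      then have a: "a \<in> space P" by (simp add: space_A)
      have "highest_bid I j a \<le> (\<Sum>j<m. highest_bid I j a)"
        using j highest_bid_nonneg[OF a] by (intro member_le_sum) auto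
      then show "norm (highest_bid I j a) \<le> norm (\<Sum>i<n. maximal_payment I i a)"
        using highest_bid_nonneg[OF a j] by (simp add: sum_maximal_payment[OF a])
    qed
  qed
  then show "j < m \<Longrightarrow> integrable A (highest_bid I j)" .
  have "(\<Sum>j<m. \<integral>a. highest_bid I j a \<partial>A) = (\<integral>a. (\<Sum>j<m. highest_bid I j a) \<partial>A)"
    using h by (intro Bochner_Integration.integral_sum[symmetric]) auto
  also have "\<dots> = (\<integral>a. (\<Sum>i<n. maximal_payment I i a) \<partial>A)"
    by (intro Bochner_Integration.integral_cong refl) (simp add: space_A sum_maximal_payment)
  also have "\<dots> = (\<Sum>i<n. \<integral>a. maximal_payment I i a \<partial>A)"
    using int by (intro Bochner_Integration.integral_sum) auto
  finally have "ereal (\<Sum>j<m. \<integral>a. highest_bid I j a \<partial>A) = (\<Sum>i<n. ereal (\<integral>a. maximal_payment I i a \<partial>A))"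
    by simp
  also have "\<dots> = (\<Sum>i<n. ext_expectation A (maximal_payment I i))"
    using int by (intro sum.cong refl) (simp add: ext_expectation_integrable)
  also note le
  finally show "ereal (\<Sum>j<m. \<integral>a. highest_bid I j a \<partial>A) \<le> liquid_welfare I A" .
qed

section \<open>Comparison with an arbitrary random allocation\<close>

lemma sum_item_probabilities_le_1:
  assumes "set_pmf p \<subseteq> feasible_allocations I"
  shows "(\<Sum>i<n. measure_pmf.prob p {x. j \<in> x i}) \<le> 1"
proof -
  \<comment> \<open>The sum is the expected number of bidders receiving \<open>j\<close>; disjoint
    bundles make this number at most 1 on the support.\<close>
  have "(\<Sum>i<n. measure_pmf.prob p {x. j \<in> x i}) = measure_pmf.expectation p (\<lambda>x. \<Sum>i<n. indicator {x. j \<in> x i} x)"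
    by (subst Bochner_Integration.integral_sum) (auto intro!: measure_pmf.integrable_const_bound[of _ 1])
  also have "\<dots> \<le> measure_pmf.expectation p (\<lambda>_. 1)"
  proof (rule integral_mono_AE)
    show "AE x in measure_pmf p. (\<Sum>i<n. indicator {x. j \<in> x i} x) \<le> (1::real)"
    proof (rule AE_pmfI)
      fix x assume "x \<in> set_pmf p"
      then have "disjoint_family_on x {..<n}"
        using assms by (auto simp: feasible_allocations_def)
      then have "i = l" if "i < n" "l < n" "j \<in> x i" "j \<in> x l" for i l
        using that by (auto simp: disjoint_family_on_def)
      then have "card {i \<in> {..<n}. j \<in> x i} \<le> 1"
        unfolding One_nat_def by (subst card_le_Suc0_iff_eq) auto
      then show "(\<Sum>i<n. indicator {x. j \<in> x i} x) \<le> (1::real)"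
        by (simp add: indicator_def sum.If_cases Int_def)
    qed
  qed (intro Bochner_Integration.integrable_sum integrable_const measure_pmf.integrable_const_bound[of _ 1], auto)
  finally show ?thesis by simp
qed

theorem optimal_liquid_welfare_le:
  assumes cce: "coarse_correlated_equilibrium I A" and nob: "nob_feasible I A"
  shows "optimal_liquid_welfare I \<le> 2 * liquid_welfare I A"
  unfolding optimal_liquid_welfare_def
proof (rule SUP_least)
  fix p assume "p \<in> {p. set_pmf p \<subseteq> feasible_allocations I}"
  then have p: "set_pmf p \<subseteq> feasible_allocations I" by simp
  define h where "h j = (\<integral>a. highest_bid I j a \<partial>A)" for j
  define Q where "Q i = (\<Sum>j<m. measure_pmf.prob p {x. j \<in> x i} * h j)" for i
  define V where "V i = (\<integral>a. val I i (won I i a) \<partial>A)" for i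
  define W where "W i = measure_pmf.expectation p (\<lambda>x. val I i (x i))" for i
  have x_sub: "x i \<subseteq> {..<m}" if "x \<in> set_pmf p" "i < n" for x i
    using p that by (auto simp: feasible_allocations_def dest!: subsetD PiE_mem[of _ _ _ i])
  have h0: "0 \<le> h j" if "j < m" for j
    unfolding h_def using that
    by (intro integral_nonneg_AE AE_I2 highest_bid_nonneg) (auto simp: space_A)
  have Q0: "0 \<le> Q i" for i
    unfolding Q_def using h0 by (intro sum_nonneg) auto
  have V0: "0 \<le> V i" if "i < n" for i
    unfolding V_def using val_nonneg[OF that won_subset] by simp
  have W: "ext_expectation (measure_pmf p) (\<lambda>x. val I i (x i)) = ereal (W i)" if i: "i < n" for i
    unfolding W_def
  proof (intro ext_expectation_integrable measure_pmf.integrable_const_bound)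
    show "AE x in measure_pmf p. norm (val I i (x i)) \<le> val I i {..<m}"
      using val_nonneg[OF i x_sub[OF _ i]] val_mono[OF i _ x_sub[OF _ i]] by (intro AE_pmfI) simp
  qed simp
  have bidder: "min (ereal (W i)) (budget I i) \<le> min (ereal (V i)) (budget I i) + ereal (Q i)"
    if i: "i < n" for i
  proof (cases "ereal (Q i) \<le> budget I i")
    case True
    \<comment> \<open>Only the law of bidder \<open>i\<close>'s own bundle enters the deviation; its
      correlation with the other bundles is discarded.\<close>
    let ?q = "map_pmf (\<lambda>x. x i) p"
    have "(\<integral>S. val I i (S \<inter> {..<m}) \<partial>measure_pmf ?q) = W i"
      unfolding W_def integral_map_pmf using x_sub[OF _ i]
      by (intro integral_cong_AE) (auto simp: AE_measure_pmf_iff Int_absorb2)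
    moreover have "Q i = (\<Sum>j<m. measure_pmf.prob ?q {S. j \<in> S} * (\<integral>a. highest_bid I j a \<partial>A))"
      by (simp add: Q_def h_def vimage_def)
    ultimately have "W i - Q i \<le> V i"
      using equilibrium_deviation_bound[OF cce i expected_highest_bids(1)[OF nob] _ True, of ?q]
      by (simp add: V_def)
    \<comment> \<open>If the minimum on the right is \<open>V i\<close>, then
      \<open>W i \<le> V i + Q i\<close> applies; if it is the budget, the left side is at most the
      budget and \<open>Q i\<close> is nonnegative.\<close>
    then show ?thesis using Q0[of i]
      by (cases "budget I i") (auto simp: min_def)
  next
    case False
    \<comment> \<open>Here \<open>Q i\<close> alone exceeds the budget, hence also the capped
      optimal value.\<close>
    then have "budget I i \<le> 0 + ereal (Q i)" by simp
    also have "\<dots> \<le> min (ereal (V i)) (budget I i) + ereal (Q i)"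
      using V0[OF i] budget_pos[OF i] by (intro add_right_mono) auto
    finally show ?thesis by (rule min.coboundedI2)
  qed
  have "(\<Sum>i<n. min (ext_expectation (measure_pmf p) (\<lambda>x. val I i (x i))) (budget I i))
      = (\<Sum>i<n. min (ereal (W i)) (budget I i))" using W by simp
  also have "\<dots> \<le> (\<Sum>i<n. min (ereal (V i)) (budget I i) + ereal (Q i))"
    using bidder by (intro sum_mono) auto
  also have "\<dots> = liquid_welfare I A + ereal (\<Sum>i<n. Q i)"
    by (simp add: liquid_welfare_eq V_def sum.distrib)
  \<comment> \<open>Grouped by items, each \<open>h j\<close> has total weight at most 1.\<close>
  also have "(\<Sum>i<n. Q i) = (\<Sum>j<m. (\<Sum>i<n. measure_pmf.prob p {x. j \<in> x i}) * h j)"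
    unfolding Q_def sum_distrib_right by (rule sum.swap)
  also have "liquid_welfare I A + ereal \<dots> \<le> liquid_welfare I A + ereal (\<Sum>j<m. h j)"
    using sum_item_probabilities_le_1[OF p] h0
    by (intro add_left_mono) (auto intro!: sum_mono mult_left_le_one_le sum_nonneg)
  \<comment> \<open>No overbidding charges the total of the highest bids to a second copy of the
    welfare, whence the factor 2.\<close>
  also have "\<dots> \<le> liquid_welfare I A + liquid_welfare I A"
    using expected_highest_bids(2)[OF nob] by (intro add_left_mono) (simp add: h_def)
  also have "\<dots> = 2 * liquid_welfare I A"
    by (cases "liquid_welfare I A") auto
  finally show "(\<Sum>i<n. min (ext_expectation (measure_pmf p) (\<lambda>x. val I i (x i))) (budget I i))
      \<le> 2 * liquid_welfare I A" .
qed

end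

section \<open>From the welfare inequality to the ratio\<close>

theorem theorem4p5:
  fixes \<V> :: "nat \<Rightarrow> (nat set \<Rightarrow> real) set" and \<B> :: "ereal set"
  assumes "\<And>m. \<V> m \<subseteq> {v. monotone_valuation m v}"
    and "\<B> \<subseteq> {0<..}"
  shows "price_of_anarchy_nob_cce \<V> \<B> \<le> 2 \<and>
    (\<forall>I A. second_price_auction I \<longrightarrow> coarse_correlated_equilibrium I A \<longrightarrow> nob_feasible I A
       \<longrightarrow> optimal_liquid_welfare I \<le> 2 * liquid_welfare I A)"
proof -
  have dist: "auction_distribution I A" if "second_price_auction I" "coarse_correlated_equilibrium I A" for I A
    using that by unfold_locales (auto simp: coarse_correlated_equilibrium_def)
  have bound: "optimal_liquid_welfare I \<le> 2 * liquid_welfare I A"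
    if "second_price_auction I" "coarse_correlated_equilibrium I A" "nob_feasible I A" for I A
    using auction_distribution.optimal_liquid_welfare_le[OF dist] that by blast
  have "optimal_liquid_welfare I / liquid_welfare I A \<le> 2"
    if "second_price_auction I" "coarse_correlated_equilibrium I A" "nob_feasible I A" for I A
  proof -
    have "0 \<le> liquid_welfare I A" "liquid_welfare I A \<noteq> \<infinity>"
      using auction_distribution.liquid_welfare_nonneg[OF dist]
        auction_distribution.liquid_welfare_finite[OF dist] that by blast+
    \<comment> \<open>If the welfare is \<open>0\<close>, the bound makes the optimum at most
      \<open>0\<close>, and the quotient in \<open>ereal\<close> is then at most \<open>0\<close>,
      as \<open>0 / 0 = 0\<close>.\<close>
    then show ?thesis using bound[OF that]
      by (cases "optimal_liquid_welfare I"; cases "liquid_welfare I A")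
        (auto simp: divide_ereal_def field_simps split: if_splits)
  qed
  then have "price_of_anarchy_nob_cce \<V> \<B> \<le> 2"
    unfolding price_of_anarchy_nob_cce_def by (intro Sup_least) (auto simp: auction_class_def)
  then show ?thesis using bound by blast
qed

end
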